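(* Let $N\ge 2$, $p\in(0,1]$, and let $\mathcal{H}_A$ have orthonormal basis $\ket{1},\ldots,\ket{N}$. For $i\in\{1,\ldots,N\}$ let $O_i$ be a unitary on $\mathcal{H}_A\otimes\mathbb{C}^2$ with $O_i\ket{i}\ket{0}=-\ket{i}\ket{1}$ and $O_i\ket{j}\ket{0}=\ket{j}\ket{1}$ for $j\neq i$, and let $\mathcal{F}_i(\rho)=p\,O_i\rho O_i^\dagger+(1-p)\rho$. Given oracle access to $\mathcal{F}_i$ for an unknown $i$, the index $i$ can be identified with probability at least $1/4$ using $\lfloor\pi/(2\theta p)\rfloor$ queries to the oracle, where $\theta=2\arcsin(1/\sqrt{N})$.
   Context: The algorithm may use a workspace, arbitrary unitaries, and calls of $\mathcal{F}_i\otimes\mathrm{Id}$, followed by a measurement whose outcome is the guess for $i$. *)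

theory Defs
  imports "Jordan_Normal_Form.Schur_Decomposition"
begin

definition mtrace :: "complex mat \<Rightarrow> complex" where
  "mtrace A = (\<Sum>k<dim_row A. A $$ (k,k))"

definition is_unitary :: "nat \<Rightarrow> complex mat \<Rightarrow> bool" where
  "is_unitary n U \<longleftrightarrow> U \<in> carrier_mat n n \<and> U * mat_adjoint U = 1\<^sub>m n \<and> mat_adjoint U * U = 1\<^sub>m n"

definition is_psd :: "nat \<Rightarrow> complex mat \<Rightarrow> bool" where
  "is_psd n M \<longleftrightarrow> M \<in> carrier_mat n n \<and>
     (\<forall>v \<in> carrier_vec n. let z = conjugate v \<bullet> (M *\<^sub>v v) in Im z = 0 \<and> Re z \<ge> 0)"

definition is_povm :: "nat \<Rightarrow> nat \<Rightarrow> (nat \<Rightarrow> complex mat) \<Rightarrow> bool" where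
  "is_povm n m M \<longleftrightarrow> (\<forall>j<m. is_psd n (M j)) \<and>
     (\<forall>r<n. \<forall>c<n. (\<Sum>j<m. M j $$ (r,c)) = (1\<^sub>m n) $$ (r,c))"

(* Standard basis: |1>,...,|N> of H_A are indices 0..N-1; on H_A \<otimes> C^2 the vector
   |j>|b> has index 2*j + b. *)

definition oracle_channel :: "real \<Rightarrow> complex mat \<Rightarrow> complex mat \<Rightarrow> complex mat" where
  "oracle_channel p Or \<rho> = complex_of_real p \<cdot>\<^sub>m (Or * \<rho> * mat_adjoint Or) + complex_of_real (1 - p) \<cdot>\<^sub>m \<rho>"

(* Phi \<otimes> Id, where Phi acts on an n-dimensional system and Id on a d-dimensional workspace;
   the joint basis index of |x>|w> is x*d + w. *)
definition tensor_id :: "nat \<Rightarrow> nat \<Rightarrow> (complex mat \<Rightarrow> complex mat) \<Rightarrow> complex mat \<Rightarrow> complex mat" where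
  "tensor_id n d \<Phi> \<sigma> =
     mat (n*d) (n*d) (\<lambda>(r,c). \<Phi> (mat n n (\<lambda>(x,y). \<sigma> $$ (x*d + r mod d, y*d + c mod d))) $$ (r div d, c div d))"

definition alg_final_state :: "nat \<Rightarrow> (complex mat \<Rightarrow> complex mat) \<Rightarrow> complex mat list \<Rightarrow> complex mat \<Rightarrow> complex mat" where
  "alg_final_state D \<Phi>' Us Uf =
     (let \<sigma> = fold (\<lambda>U \<sigma>. \<Phi>' (U * \<sigma> * mat_adjoint U)) Us (mat D D (\<lambda>(r,c). if r = 0 \<and> c = 0 then 1 else 0))
      in Uf * \<sigma> * mat_adjoint Uf)"

end

theory Submission
  imports Defs
begin

text \<open>
  A query on \<open>|a\<rangle>|0\<rangle>\<close> is heralded: with probability \<open>p\<close> it applies the Grover phase flip to \<open>a\<close> and sets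
  the qubit to \<open>1\<close>, otherwise nothing happens. Moving the qubit into the workspace records the
  outcome and supplies a fresh \<open>|0\<rangle>\<close>; conditioned on success one applies the diffusion operator.
  After \<open>T\<close> queries the number \<open>K\<close> of completed Grover iterations is binomial with parameters \<open>T\<close>
  and \<open>p\<close>, and measuring finds \<open>i\<close> with probability \<open>sin\<^sup>2 ((2 K + 1) \<theta> / 2)\<close>.

  Since \<open>sin\<^sup>2 (x / 2) \<ge> 1 - (x - \<pi>)\<^sup>2 / 4\<close>, the expectation is bounded through the mean and variance of
  \<open>K\<close>, which suffices for \<open>N \<ge> 25\<close>. For \<open>N \<le> 24\<close> one performs the diffusion only after the first
  success. Later successes merely flip signs of amplitudes in the measurement basis, so the
  success probability is \<open>(1 - (1 - p)\<^sup>T) (3 - 4 / N)\<^sup>2 / N + (1 - p)\<^sup>T / N\<close>.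
\<close>

subsection \<open>Success probability of the randomly interrupted Grover iteration\<close>

text \<open>The operator \<open>2 |f><f| - 1\<close> on real amplitudes, the reflection fixing
  \<open>f\<close> when \<open>f\<close> is a unit vector; for \<open>f = uniform_amp N\<close> it
  is Grover's diffusion.\<close>

definition reflect :: "nat \<Rightarrow> (nat \<Rightarrow> real) \<Rightarrow> (nat \<Rightarrow> real) \<Rightarrow> nat \<Rightarrow> real" where
  "reflect N f a j = 2 * f j * (\<Sum>l<N. f l * a l) - a j"

definition uniform_amp :: "nat \<Rightarrow> nat \<Rightarrow> real" where
  "uniform_amp N j = 1 / sqrt (real N)"

definition flip :: "nat \<Rightarrow> (nat \<Rightarrow> real) \<Rightarrow> nat \<Rightarrow> real" where
  "flip i a = a(i := - a i)"

text \<open>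
  The probability of measuring \<open>i\<close> after \<open>n\<close> further queries. The binary digits of \<open>h\<close> record
  which of the earlier queries succeeded; a success is followed by a diffusion only if \<open>h \<in> C\<close>.
\<close>
fun hit_prob :: "nat \<Rightarrow> real \<Rightarrow> nat set \<Rightarrow> nat \<Rightarrow> nat \<Rightarrow> (nat \<Rightarrow> real) \<Rightarrow> nat \<Rightarrow> real" where
  "hit_prob N p C i 0 a h = (a i)\<^sup>2"
| "hit_prob N p C i (Suc n) a h =
     p * hit_prob N p C i n
           (if h \<in> C then reflect N (uniform_amp N) (flip i a) else flip i a) (2 * h + 1)
     + (1 - p) * hit_prob N p C i n a (2 * h)"

lemma sum_flip:
  assumes "i < N"
  shows "(\<Sum>l<N. flip i a l) = (\<Sum>l\<in>{..<N} - {i}. a l) - a i"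
  using assms by (simp add: flip_def sum.remove[of _ i])

lemma reflect_uniform:
  assumes "N > 0"
  shows "reflect N (uniform_amp N) a j = 2 / real N * (\<Sum>l<N. a l) - a j"
proof -
  have "uniform_amp N j * (\<Sum>l<N. uniform_amp N l * a l) = (1 / sqrt N * (1 / sqrt N)) * (\<Sum>l<N. a l)"
    by (simp add: uniform_amp_def sum_divide_distrib)
  also have "1 / sqrt N * (1 / sqrt N) = 1 / real N"
    by (simp add: real_sqrt_mult_self)
  finally show ?thesis by (simp add: reflect_def)
qed

text \<open>After the first success only sign flips occur, which do not affect the measurement.\<close>
lemma hit_prob_after_stop:
  assumes "h > 0"
  shows "hit_prob N p {0} i n a h = (a i)\<^sup>2"
  using assms
  by (induction n arbitrary: a h) (auto simp: flip_def algebra_simps)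

text \<open>While all queries fail, the history stays \<open>0\<close> and the amplitudes stay
  uniform. The first success completes one Grover iteration, after which
  \<open>hit_prob_after_stop\<close> freezes the weight of \<open>i\<close>.\<close>

lemma hit_prob_first_success:
  assumes "N \<ge> 2" "i < N"
  shows "hit_prob N p {0} i n (uniform_amp N) 0 =
           (1 - (1 - p) ^ n) * ((3 - 4 / N)\<^sup>2 / N) + (1 - p) ^ n / N"
proof (induction n)
  case 0
  then show ?case by (simp add: uniform_amp_def power_divide)
next
  case (Suc n)
  have c: "real (card ({..<N} - {i})) = real N - 1"
    using assms by (simp add: of_nat_diff)
  have "reflect N (uniform_amp N) (flip i (uniform_amp N)) i
     = (3 - 4 / N) * (1 / sqrt N)"
  proof -
    define t where "t = 1 / sqrt N"
    \<comment> \<open>The flipped uniform amplitudes sum to \<open>(N - 1) * t - t\<close>, and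
      subtracting the flipped entry \<open>- t\<close> contributes \<open>+ t\<close>.\<close>
    have "2 / real N * ((real N - 1) * t - t) + t = (3 - 4 / N) * t"
      using assms by (simp add: field_simps)
    then show ?thesis
      unfolding t_def[symmetric] using assms c
      by (simp add: reflect_uniform sum_flip) (simp add: flip_def uniform_amp_def flip: t_def)
  qed
  then have s: "(reflect N (uniform_amp N) (flip i (uniform_amp N)) i)\<^sup>2 = (3 - 4 / N)\<^sup>2 / N"
    by (simp add: power_mult_distrib power_divide)
  have "p * S + (1 - p) * ((1 - q) * S + q / N) = (1 - (1 - p) * q) * S + (1 - p) * q / N" for S q
    using assms by (simp add: field_simps)
  from this[of "(3 - 4 / N)\<^sup>2 / N" "(1 - p) ^ n"] show ?case
    using s Suc.IH by (simp add: hit_prob_after_stop)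
qed

text \<open>After \<open>k\<close> Grover iterations \<open>x = (2 k + 1) \<theta> / 2\<close>.\<close>
definition grover_amp :: "nat \<Rightarrow> nat \<Rightarrow> real \<Rightarrow> nat \<Rightarrow> real" where
  "grover_amp N i x j = (if j = i then sin x else cos x / sqrt (real N - 1))"

lemma sin_cos_grover_angle:
  assumes "N \<ge> 2"
  shows "sin (arcsin (1 / sqrt (real N))) = 1 / sqrt N"
    and "cos (arcsin (1 / sqrt (real N))) = sqrt (real N - 1) / sqrt N"
proof -
  show "sin (arcsin (1 / sqrt (real N))) = 1 / sqrt N"
    using assms by (intro sin_arcsin) (auto simp: field_simps intro: order_trans[of _ 0])
  have "cos (arcsin (1 / sqrt N)) = sqrt (1 - (1 / sqrt N)\<^sup>2)"
    using assms by (intro cos_arcsin) (auto simp: field_simps intro: order_trans[of _ 0])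
  also have "\<dots> = sqrt (real N - 1) / sqrt N"
    using assms by (simp add: power_divide real_sqrt_divide[symmetric] field_simps)
  finally show "cos (arcsin (1 / sqrt (real N))) = sqrt (real N - 1) / sqrt N" .
qed

text \<open>Both factors act as reflections on the plane spanned by \<open>|i>\<close> and the
  uniform superposition of the other basis vectors. The two axes enclose the angle
  \<open>\<theta> / 2\<close>, so the composition is a rotation by \<open>\<theta>\<close>.\<close>

lemma reflect_flip_grover:
  fixes \<theta> :: real
  assumes N: "N \<ge> 2" "i < N" and \<theta>: "\<theta> = 2 * arcsin (1 / sqrt N)"
  shows "reflect N (uniform_amp N) (flip i (grover_amp N i x)) = grover_amp N i (x + \<theta>)"
proof -
  define r where "r = sqrt (real N - 1)"
  have r: "r > 0" "r * r = real N - 1" using N by (auto simp: r_def)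
  note s = sin_cos_grover_angle(1)[OF N(1)] and c = sin_cos_grover_angle(2)[OF N(1), folded r_def]
  have sin: "sin \<theta> = 2 * r / N"
    by (simp add: \<theta> sin_double s c)
  have cos: "cos \<theta> = 1 - 2 / N"
    by (simp add: \<theta> cos_double_sin s power_divide)
  have sum: "(\<Sum>l<N. flip i (grover_amp N i x) l) = r * cos x - sin x"
  proof -
    have "(\<Sum>l\<in>{..<N} - {i}. grover_amp N i x l) = (\<Sum>l\<in>{..<N} - {i}. cos x / r)"
      by (intro sum.cong) (auto simp: grover_amp_def r_def)
    also have "\<dots> = (real N - 1) * (cos x / r)"
      using N by (simp add: of_nat_diff)
    also have "\<dots> = r * cos x"
      using r by (simp flip: r(2))
    finally show ?thesis using N by (simp add: sum_flip) (simp add: grover_amp_def)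
  qed
  show ?thesis
  proof
    fix j
    show "reflect N (uniform_amp N) (flip i (grover_amp N i x)) j = grover_amp N i (x + \<theta>) j"
    proof (cases "j = i")
      case True
      then show ?thesis using N
        by (simp add: reflect_uniform sum, simp add: flip_def grover_amp_def sin_add sin cos)
           (simp add: field_simps)
    next
      case False
      have "2 / real N * (r * cos x - sin x) - cos x / r = (cos x * (1 - 2 / N) - sin x * (2 * r / N)) / r"
      proof -
        have "(2 / real N * (r * cos x - sin x) - cos x / r) * r
            = 2 / real N * ((r * r) * cos x - sin x * r) - cos x"
          using r(1) by (simp add: left_diff_distrib right_diff_distrib mult_ac)
        also have "\<dots> = cos x * (1 - 2 / N) - sin x * (2 * r / N)"
          unfolding r(2) using N by (simp add: field_simps)
        finally show ?thesis using r(1) by (simp add: eq_divide_eq)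
      qed
      with False show ?thesis using N
        by (simp add: reflect_uniform sum, simp add: flip_def grover_amp_def cos_add sin cos r_def)
    qed
  qed
qed

lemma uniform_eq_grover_amp:
  assumes "N \<ge> 2"
  shows "uniform_amp N = grover_amp N i (arcsin (1 / sqrt N))"
  using assms by (auto simp: fun_eq_iff uniform_amp_def grover_amp_def sin_cos_grover_angle)

text \<open>This is \<open>|sin y| \<le> |y|\<close> at \<open>y = (x - pi) / 2\<close>, after
  passing to the complementary cosine.\<close>

lemma sin_squared_ge: "(sin (x / 2))\<^sup>2 \<ge> 1 - (x - pi)\<^sup>2 / (4::real)"
proof -
  have "(cos (x / 2))\<^sup>2 = (sin ((x - pi) / 2))\<^sup>2"
    by (simp add: diff_divide_distrib sin_diff)
  also have "\<dots> \<le> ((x - pi) / 2)\<^sup>2"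
    using abs_sin_x_le_abs_x[of "(x - pi) / 2"] by (simp only: abs_le_square_iff)
  finally show ?thesis by (simp add: sin_squared_eq power_divide)
qed

text \<open>
  The right-hand side is the expectation of the quadratic bound \<open>sin_squared_ge\<close> when the number
  of successes is binomially distributed.
\<close>
lemma hit_prob_grover_ge:
  fixes \<theta> :: real
  assumes N: "N \<ge> 2" "i < N" and \<theta>: "\<theta> = 2 * arcsin (1 / sqrt N)" and p: "0 \<le> p" "p \<le> 1"
  shows "hit_prob N p UNIV i n (grover_amp N i (x / 2)) h \<ge>
           1 - (x + 2 * \<theta> * p * n - pi)\<^sup>2 / 4 - \<theta>\<^sup>2 * n * p * (1 - p)"
proof (induction n arbitrary: x h)
  case 0
  show ?case using sin_squared_ge[of x] by (simp add: grover_amp_def)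
next
  case (Suc n)
  define u where "u = x + 2 * \<theta> * p * n - pi"
  have 1: "x / 2 + \<theta> = (x + 2 * \<theta>) / 2" by simp
  have "1 - (x + 2 * \<theta> * p * Suc n - pi)\<^sup>2 / 4 - \<theta>\<^sup>2 * Suc n * p * (1 - p)
     = 1 - (u + 2 * \<theta> * p)\<^sup>2 / 4 - \<theta>\<^sup>2 * Suc n * p * (1 - p)"
    by (simp add: u_def algebra_simps)
  \<comment> \<open>The mean of \<open>(u + 2 * \<theta>)\<^sup>2\<close> and
    \<open>u\<^sup>2\<close> with weights \<open>p\<close> and \<open>1 - p\<close> exceeds the
    square of the mean by the variance \<open>4 * \<theta>\<^sup>2 * p * (1 - p)\<close>; divided by
    4 this is one more summand of the last term.\<close>
  also have "\<dots> = p * (1 - (u + 2 * \<theta>)\<^sup>2 / 4 - \<theta>\<^sup>2 * n * p * (1 - p))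
     + (1 - p) * (1 - u\<^sup>2 / 4 - \<theta>\<^sup>2 * n * p * (1 - p))"
    by (simp add: power2_eq_square field_simps)
  also have "\<dots> \<le> p * hit_prob N p UNIV i n (grover_amp N i ((x + 2 * \<theta>) / 2)) (2 * h + 1)
     + (1 - p) * hit_prob N p UNIV i n (grover_amp N i (x / 2)) (2 * h)"
    using p Suc.IH[of "x + 2 * \<theta>" "2 * h + 1"] Suc.IH[of x "2 * h"]
    by (intro add_mono mult_left_mono) (simp_all add: u_def algebra_simps)
  also have "\<dots> = hit_prob N p UNIV i (Suc n) (grover_amp N i (x / 2)) h"
    using reflect_flip_grover[OF N \<theta>] by (simp add: 1)
  finally show ?case .
qed

section \<open>Elementary estimates for the query count and the angle\<close>

lemma floor_ge_fraction:
  fixes v :: real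
  assumes "real k \<le> v"
  shows "real k / (real k + 1) * v \<le> real (nat \<lfloor>v\<rfloor>)"
proof -
  define m where "m = nat \<lfloor>v\<rfloor>"
  have "k \<le> m" using assms by (simp add: m_def le_nat_floor)
  moreover have "v \<le> real m + 1" unfolding m_def using assms by linarith
  \<comment> \<open>\<open>k * v \<le> k * (m + 1) = k * m + k\<close>, and
    \<open>k \<le> m\<close>.\<close>
  ultimately have "real k * v \<le> real k * real m + real m"
    using mult_left_mono[of v "real m + 1" "real k"] by (simp add: algebra_simps)
  then show ?thesis unfolding m_def[symmetric] by (simp add: field_simps)
qed

text \<open>For \<open>x = pi / (2 * \<theta>)\<close> the right-hand side is the expected number of
  successes, bounded here independently of \<open>p\<close>. The floor estimate applies because
  \<open>p \<le> 1\<close> gives \<open>x / p \<ge> x \<ge> k\<close>.\<close>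

lemma mult_floor_divide_ge:
  fixes x p :: real
  assumes "0 < p" "p \<le> 1" "real k \<le> x"
  shows "real k / (real k + 1) * x \<le> p * real (nat \<lfloor>x / p\<rfloor>)"
proof -
  have "0 \<le> x" using assms by linarith
  then have "x \<le> x / p" using assms by (simp add: pos_le_divide_eq mult_left_le)
  then have "real k / (real k + 1) * (x / p) \<le> real (nat \<lfloor>x / p\<rfloor>)"
    using assms by (intro floor_ge_fraction) simp
  then have "p * (real k / (real k + 1) * (x / p)) \<le> p * real (nat \<lfloor>x / p\<rfloor>)"
    using assms by (intro mult_left_mono) auto
  then show ?thesis using assms by simp
qed

text \<open>Follows from \<open>1 - p \<le> exp (- p)\<close>; the quadratic Taylor polynomial
  replaces \<open>exp\<close> so that rational \<open>y\<close> give rational bounds.\<close>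

lemma miss_prob_le:
  fixes p y :: real
  assumes "0 \<le> p" "p \<le> 1" "0 \<le> y" "y \<le> p * real n"
  shows "(1 - p) ^ n \<le> 1 / (1 + y + y\<^sup>2 / 2)"
proof -
  have "(1 - p) ^ n \<le> exp (- p) ^ n"
    using assms exp_ge_add_one_self[of "- p"] by (intro power_mono) auto
  also have "\<dots> = exp (- (p * real n))" by (simp add: exp_of_nat_mult[symmetric] mult.commute)
  also have "\<dots> \<le> exp (- y)" using assms by simp
  also have "\<dots> = 1 / exp y" by (simp add: exp_minus inverse_eq_divide)
  also have "\<dots> \<le> 1 / (1 + y + y\<^sup>2 / 2)"
    using assms exp_lower_Taylor_quadratic[of y]
    by (intro divide_left_mono) (auto intro!: mult_pos_pos add_pos_nonneg)
  finally show ?thesis .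
qed

text \<open>Reduces an angle bound for all \<open>N \<ge> s\<^sup>2\<close> to one comparison with
  \<open>sin \<phi>\<close>.\<close>

lemma arcsin_inv_sqrt_le:
  fixes s \<phi> :: real
  assumes "1 / s \<le> sin \<phi>" "0 < s" "s\<^sup>2 \<le> real N" "0 \<le> \<phi>" "\<phi> \<le> pi / 2"
  shows "arcsin (1 / sqrt N) \<le> \<phi>"
proof -
  have "s \<le> sqrt N" using assms by (intro real_le_rsqrt)
  then have "1 / sqrt N \<le> sin \<phi>"
    using assms by (intro order_trans[OF _ assms(1)]) (auto simp: frac_le)
  moreover have "0 \<le> 1 / sqrt N" by simp
  ultimately have "arcsin (1 / sqrt N) \<le> arcsin (sin \<phi>)"
    by (intro arcsin_le_arcsin) (auto intro: order_trans[of _ 0])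
  then show ?thesis using assms by (simp add: arcsin_sin)
qed

text \<open>The term \<open>q / N\<close> is discarded; the rest decreases in \<open>q\<close>, so
  \<open>q = c\<close> is the worst case.\<close>

lemma first_success_bound:
  fixes q s c N :: real
  assumes "0 \<le> q" "q \<le> c" "c \<le> 1" "1/4 \<le> (1 - c) * s" "0 \<le> s" "0 < N"
  shows "1/4 \<le> (1 - q) * s + q / N"
proof -
  have "(1 - c) * s \<le> (1 - q) * s" using assms by (intro mult_right_mono) auto
  moreover have "0 \<le> q / N" using assms by simp
  ultimately show ?thesis using assms by linarith
qed

text \<open>Here \<open>q\<close> is the probability of no success and \<open>s\<close> the weight
  of \<open>i\<close> after one iteration. For \<open>N \<ge> 5\<close> an upper bound on the angle
  yields a lower bound on \<open>x\<close>, hence on the expected number of successes, hence an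
  upper bound on \<open>q\<close>, while \<open>s\<close> is checked for each
  \<open>N\<close>.\<close>

lemma hit_prob_small:
  assumes N: "2 \<le> N" "N \<le> 24" and i: "i < N" and p: "0 < p" "p \<le> 1"
  shows "hit_prob N p {0} i (nat \<lfloor>pi / (2 * (2 * arcsin (1 / sqrt N)) * p)\<rfloor>) (uniform_amp N) 0 \<ge> 1/4"
proof -
  define \<theta> where "\<theta> = 2 * arcsin (1 / sqrt N)"
  define x where "x = pi / (2 * \<theta>)"
  define T where "T = nat \<lfloor>x / p\<rfloor>"
  define s where "s = (3 - 4 / real N)\<^sup>2 / N"
  define q where "q = (1 - p) ^ T"
  have "arcsin (1 / sqrt N) > arcsin 0"
    using N by (intro arcsin_less_arcsin) auto
  then have \<theta>: "\<theta> > 0" by (simp add: \<theta>_def)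
  have q: "0 \<le> q" "q \<le> 1" using p by (auto simp: q_def power_le_one)
  have s0: "0 \<le> s" by (simp add: s_def)
  have x_ge: "x \<ge> pi / (4 * \<phi>)" if "arcsin (1 / sqrt N) \<le> \<phi>" for \<phi>
    unfolding x_def using that \<theta> by (intro divide_left_mono) (auto simp: \<theta>_def)
  have q_le: "q \<le> 1 / (1 + y + y\<^sup>2 / 2)" if "0 \<le> y" "real k \<le> x" "y \<le> real k / (real k + 1) * x" for y k
    unfolding q_def using that p mult_floor_divide_ge[OF p, of k x]
    by (intro miss_prob_le) (auto simp: T_def)
  have "1/4 \<le> (1 - q) * s + q / N"
  proof -
    consider "N \<le> 4" | "5 \<le> N" "N \<le> 10" | "11 \<le> N" "N \<le> 15" | "16 \<le> N" "N \<le> 24"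
      using N by linarith
    then show ?thesis
    proof cases
      case 1
      then have Nset: "N \<in> {2, 3, 4}" using N by auto
      \<comment> \<open>Both outcomes already have weight at least \<open>1/4\<close>, so every
        mixture of them does.\<close>
      have "s \<ge> 1/4" "1 / real N \<ge> 1/4"
        using Nset by (auto simp: s_def power2_eq_square)
      then have "(1 - q) * (1/4) + q * (1/4) \<le> (1 - q) * s + q * (1 / real N)"
        using q by (intro add_mono mult_left_mono) auto
      moreover have "(1 - q) * (1/4) + q * (1/4) = 1/4" by (simp add: field_simps)
      ultimately show ?thesis by (simp only: times_divide_eq_right mult_1_right)
    next
      case 2
      then have Nset: "N \<in> {5, 6, 7, 8, 9, 10}" using N by auto
      have "arcsin (1 / sqrt N) \<le> pi / 4"
        using N by (intro arcsin_inv_sqrt_le[of "sqrt 2"]) (auto simp: sin_45 real_div_sqrt field_simps)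
      then have "x \<ge> pi / (4 * (pi / 4))" by (rule x_ge)
      then have "x \<ge> 1" by simp
      \<comment> \<open>In each range \<open>y\<close> is \<open>k / (k + 1)\<close> times the lower
        bound for \<open>x\<close>, here with \<open>k = 1\<close>. The resulting right-hand side is
        the constant \<open>c\<close> below, here \<open>8/13\<close>.\<close>
      then have "q \<le> 1 / (1 + 1/2 + (1/2)\<^sup>2 / 2)"
        by (intro q_le[of "1/2" 1]) auto
      moreover have "s \<ge> 67/100"
        using Nset by (auto simp: s_def power2_eq_square)
      ultimately show ?thesis using q s0 N
        by (intro first_success_bound[where c = "8/13"]) (auto simp: power2_eq_square)
    next
      case 3
      then have Nset: "N \<in> {11, 12, 13, 14, 15}" using N by auto
      have "arcsin (1 / sqrt N) \<le> pi / 6"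
        using 3 by (intro arcsin_inv_sqrt_le[of 2]) (auto simp: sin_30)
      then have "x \<ge> pi / (4 * (pi / 6))" by (rule x_ge)
      also have "pi / (4 * (pi / 6)) = 3/2" by simp
      finally have "q \<le> 1 / (1 + 3/4 + (3/4)\<^sup>2 / 2)"
        by (intro q_le[of "3/4" 1]) auto
      moreover have "s \<ge> 498/1000"
        using Nset by (auto simp: s_def power2_eq_square)
      ultimately show ?thesis using q s0 N
        by (intro first_success_bound[where c = "32/65"]) (auto simp: power2_eq_square)
    next
      case 4
      then have Nset: "N \<in> {16, 17, 18, 19, 20, 21, 22, 23, 24}" using N by auto
      \<comment> \<open>The target \<open>1/4\<close> is \<open>1 / sqrt 16\<close>; the half-angle
        formula with \<open>sqrt 3 \<le> 7/4\<close> yields exactly its square.\<close>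
      have "(sin (pi / 12))\<^sup>2 = (1 - cos (pi / 6)) / 2"
        using cos_double_sin[of "pi / 12"] by simp
      also have "\<dots> \<ge> (1/4)\<^sup>2"
      proof -
        have "sqrt 3 \<le> 7/4" by (rule real_le_lsqrt) (auto simp: power2_eq_square)
        then show ?thesis by (simp add: cos_30 power2_eq_square)
      qed
      finally have "1/4 \<le> sin (pi / 12)"
        by (rule power2_le_imp_le) (auto intro!: sin_ge_zero)
      then have "arcsin (1 / sqrt N) \<le> pi / 12"
        using 4 by (intro arcsin_inv_sqrt_le[of 4]) auto
      then have "x \<ge> pi / (4 * (pi / 12))" by (rule x_ge)
      also have "pi / (4 * (pi / 12)) = 3" by simp
      finally have "q \<le> 1 / (1 + 9/4 + (9/4)\<^sup>2 / 2)"
        by (intro q_le[of "9/4" 3]) auto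
      moreover have "s \<ge> 33/100"
        using Nset by (auto simp: s_def power2_eq_square)
      ultimately show ?thesis using q s0 N
        by (intro first_success_bound[where c = "32/185"]) (auto simp: power2_eq_square)
    qed
  qed
  moreover have "nat \<lfloor>pi / (2 * (2 * arcsin (1 / sqrt N)) * p)\<rfloor> = T"
    by (simp add: T_def x_def \<theta>_def)
  ultimately show ?thesis
    using N i by (simp add: hit_prob_first_success q_def s_def)
qed

lemma sin_ge_cubic:
  fixes x :: real
  assumes "0 \<le> x"
  shows "x - x ^ 3 / 6 \<le> sin x"
proof -
  have "\<bar>sin x - x\<bar> \<le> x ^ 3 / 6"
    using Maclaurin_sin_bound[of x 3] assms by (simp add: eval_nat_numeral sin_coeff_def)
  then show ?thesis by linarith
qed

text \<open>As \<open>8/15 = (16/5) / 6\<close>, monotonicity of sine reduces this to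
  \<open>sin (8/15) \<ge> 1/2 = sin (pi / 6)\<close>.\<close>

lemma pi_le_16_div_5: "pi \<le> 16 / 5"
proof (rule ccontr)
  assume "\<not> ?thesis"
  then have "sin (8/15) < sin (pi / 6)"
    using pi_less_4 by (intro sin_monotone_2pi) auto
  moreover have "sin (8/15 :: real) \<ge> 1/2"
    using sin_ge_cubic[of "8/15"] by (simp add: power3_eq_cube)
  ultimately show False by (simp add: sin_30)
qed

text \<open>The mean doubled angle misses \<open>pi\<close> by at most \<open>\<theta>\<close> and
  the variance term is at most \<open>\<theta> * pi / 2\<close>; \<open>N \<ge> 25\<close> makes
  \<open>\<theta>\<close> small enough for both.\<close>

lemma hit_prob_large:
  assumes N: "25 \<le> N" and i: "i < N" and p: "0 < p" "p \<le> 1"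
  shows "hit_prob N p UNIV i (nat \<lfloor>pi / (2 * (2 * arcsin (1 / sqrt N)) * p)\<rfloor>) (uniform_amp N) 0 \<ge> 1/4"
proof -
  define \<theta> where "\<theta> = 2 * arcsin (1 / sqrt N)"
  define T where "T = nat \<lfloor>pi / (2 * \<theta> * p)\<rfloor>"
  have "arcsin (1 / sqrt N) > arcsin 0"
    using N by (intro arcsin_less_arcsin) auto
  then have \<theta>0: "\<theta> > 0" by (simp add: \<theta>_def)
  \<comment> \<open>\<open>5 = sqrt 25\<close>, and \<open>21/100\<close> slightly exceeds
    \<open>arcsin (1/5)\<close>.\<close>
  have "1/5 \<le> sin (21/100 :: real)"
    using sin_ge_cubic[of "21/100"] by (simp add: power3_eq_cube)
  then have "arcsin (1 / sqrt N) \<le> 21/100"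
    using N pi_ge_two by (intro arcsin_inv_sqrt_le[of 5]) auto
  then have \<theta>: "\<theta> \<le> 42/100" by (simp add: \<theta>_def)
  have v: "0 \<le> pi / (2 * \<theta> * p)" using \<theta>0 p by simp
  have "real T \<le> pi / (2 * \<theta> * p)" "pi / (2 * \<theta> * p) \<le> real T + 1"
    unfolding T_def using v by linarith+
  then have Tle: "2 * \<theta> * p * T \<le> pi" and Tge: "pi \<le> 2 * \<theta> * p * T + 2 * \<theta> * p"
    using \<theta>0 p by (auto simp: field_simps)
  \<comment> \<open>The mean doubled angle minus \<open>pi\<close>, the uniform state starting at
    \<open>\<theta>\<close>. Rounding \<open>T\<close> down loses at most
    \<open>2 * \<theta> * p\<close>, so \<open>u\<close> lies between
    \<open>\<theta> - 2 * \<theta> * p\<close> and \<open>\<theta>\<close>.\<close>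
  define u where "u = \<theta> + 2 * \<theta> * p * T - pi"
  have "2 * \<theta> * p \<le> 2 * \<theta>" using \<theta>0 p by (simp add: mult_left_le)
  then have "\<bar>u\<bar> \<le> \<theta>" using Tle Tge by (simp add: u_def)
  then have "u\<^sup>2 \<le> (42/100)\<^sup>2" using \<theta> by (intro power2_le_iff_abs_le[THEN iffD2]) auto
  moreover have "\<theta>\<^sup>2 * T * p * (1 - p) \<le> 42/100 * (pi / 2)"
  proof -
    have "\<theta>\<^sup>2 * T * p * (1 - p) = \<theta> * (\<theta> * p * T) * (1 - p)" by (simp add: power2_eq_square)
    also have "\<dots> \<le> \<theta> * (\<theta> * p * T)" using \<theta>0 p by (intro mult_left_le) auto
    also have "\<dots> \<le> 42/100 * (pi / 2)" using \<theta> \<theta>0 p Tle by (intro mult_mono) auto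
    finally show ?thesis .
  qed
  \<comment> \<open>The losses are at most \<open>0.0441\<close> and
    \<open>0.42 * 1.6 = 0.672\<close>, together below \<open>3/4\<close>.\<close>
  ultimately have "1/4 \<le> 1 - u\<^sup>2 / 4 - \<theta>\<^sup>2 * T * p * (1 - p)"
    using pi_le_16_div_5 by (simp add: power2_eq_square)
  also have "\<dots> \<le> hit_prob N p UNIV i T (grover_amp N i (\<theta> / 2)) 0"
    using hit_prob_grover_ge[OF _ i \<theta>_def, of p \<theta> T 0] N p by (simp add: u_def)
  also have "grover_amp N i (\<theta> / 2) = uniform_amp N"
    using uniform_eq_grover_amp[of N i] N by (simp add: \<theta>_def)
  finally show ?thesis by (simp add: T_def \<theta>_def)
qed

subsection \<open>Channels on pure states\<close>

lemma adjoint_carrier [simp]: "A \<in> carrier_mat n m \<Longrightarrow> mat_adjoint A \<in> carrier_mat m n"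
  by (auto simp: mat_adjoint_def)

lemma dim_adjoint [simp]: "dim_row (mat_adjoint A) = dim_col A" "dim_col (mat_adjoint A) = dim_row A"
  by (auto simp: mat_adjoint_def)

lemma index_adjoint [simp]:
  fixes A :: "complex mat"
  assumes "A \<in> carrier_mat n m" "r < m" "c < n"
  shows "mat_adjoint A $$ (r, c) = cnj (A $$ (c, r))"
  using assms by (auto simp: mat_adjoint_def mat_of_rows_def conjugate_complex_def)

lemma index_mult:
  assumes "A \<in> carrier_mat n k" "B \<in> carrier_mat k m" "r < n" "c < m"
  shows "(A * B) $$ (r, c) = (\<Sum>l<k. A $$ (r, l) * B $$ (l, c))"
  using assms by (simp add: scalar_prod_def lessThan_atLeast0)

lemma index_mult_vec:
  assumes "A \<in> carrier_mat n k" "v \<in> carrier_vec k" "r < n"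
  shows "(A *\<^sub>v v) $ r = (\<Sum>l<k. A $$ (r, l) * v $ l)"
  using assms by (simp add: scalar_prod_def lessThan_atLeast0)

lemma index_sandwich:
  fixes A X :: "complex mat"
  assumes "A \<in> carrier_mat n n" "X \<in> carrier_mat n n" "r < n" "c < n"
  shows "(A * X * mat_adjoint A) $$ (r, c) =
    (\<Sum>k<n. (\<Sum>l<n. A $$ (r, l) * X $$ (l, k)) * cnj (A $$ (c, k)))"
  using assms adjoint_carrier[OF assms(1)]
  by (subst index_mult[of _ n n]) (auto simp del: index_mult_mat simp: index_mult[of _ n n])

definition outer :: "complex vec \<Rightarrow> complex mat" where
  "outer v = mat (dim_vec v) (dim_vec v) (\<lambda>(r, c). v $ r * cnj (v $ c))"

lemma outer_carrier [simp]: "v \<in> carrier_vec n \<Longrightarrow> outer v \<in> carrier_mat n n"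
  by (simp add: outer_def)

lemma sandwich_outer:
  assumes A: "A \<in> carrier_mat n n" and v: "v \<in> carrier_vec n"
  shows "A * outer v * mat_adjoint A = outer (A *\<^sub>v v)"
proof (rule eq_matI)
  fix r c assume rc: "r < dim_row (outer (A *\<^sub>v v))" "c < dim_col (outer (A *\<^sub>v v))"
  then have rc: "r < n" "c < n" using A by (auto simp: outer_def)
  have "(A * outer v * mat_adjoint A) $$ (r, c) =
    (\<Sum>k<n. (\<Sum>l<n. A $$ (r, l) * (v $ l * cnj (v $ k))) * cnj (A $$ (c, k)))"
    using A v rc by (simp add: index_sandwich[of _ n] outer_def del: index_mult_mat(1))
  also have "\<dots> = (\<Sum>l<n. A $$ (r, l) * v $ l) * cnj (\<Sum>k<n. A $$ (c, k) * v $ k)"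
    by (simp add: sum_distrib_left sum_distrib_right mult_ac)
  also have "\<dots> = outer (A *\<^sub>v v) $$ (r, c)"
    using A v rc by (simp add: outer_def index_mult_vec[of _ n n] del: index_mult_mat_vec)
  finally show "(A * outer v * mat_adjoint A) $$ (r, c) = outer (A *\<^sub>v v) $$ (r, c)" .
qed (use A v adjoint_carrier[OF A] in \<open>auto simp: outer_def\<close>)

lemma sandwich_linear:
  fixes A :: "complex mat"
  assumes "A \<in> carrier_mat n n" "X \<in> carrier_mat n n" "Y \<in> carrier_mat n n"
  shows "A * (a \<cdot>\<^sub>m X + b \<cdot>\<^sub>m Y) * mat_adjoint A =
     a \<cdot>\<^sub>m (A * X * mat_adjoint A) + b \<cdot>\<^sub>m (A * Y * mat_adjoint A)"
proof -
  note B = adjoint_carrier[OF assms(1)]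
  have "A * (a \<cdot>\<^sub>m X + b \<cdot>\<^sub>m Y) = a \<cdot>\<^sub>m (A * X) + b \<cdot>\<^sub>m (A * Y)"
    using assms by (subst mult_add_distrib_mat[of _ n n _ n]) (auto simp: mult_smult_distrib[of _ n n _ n])
  then show ?thesis
    using assms B
    by (simp, subst add_mult_distrib_mat[of _ n n _ _ n]) (auto simp: mult_smult_assoc_mat[of _ n n _ n])
qed

text \<open>\<open>A \<otimes> Id\<close> on a joint index \<open>x * d + w\<close>.\<close>
definition ampliation :: "nat \<Rightarrow> nat \<Rightarrow> complex mat \<Rightarrow> complex mat" where
  "ampliation n d A = mat (n * d) (n * d)
     (\<lambda>(r, c). if r mod d = c mod d then A $$ (r div d, c div d) else 0)"

lemma ampliation_carrier [simp]: "ampliation n d A \<in> carrier_mat (n * d) (n * d)"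
  by (simp add: ampliation_def)

lemma dim_ampliation [simp]:
  "dim_row (ampliation n d A) = n * d" "dim_col (ampliation n d A) = n * d"
  by (simp_all add: ampliation_def)

lemma mult_add_less_mult: "x < n \<Longrightarrow> w < d \<Longrightarrow> x * d + w < n * (d::nat)"
proof -
  assume "x < n" "w < d"
  then have "x * d + w < Suc x * d" "Suc x * d \<le> n * d"
    using mult_le_mono1[of "Suc x" n d] by auto
  then show ?thesis by linarith
qed

lemma sum_div_mod:
  fixes g :: "nat \<Rightarrow> nat \<Rightarrow> 'a::comm_monoid_add"
  shows "(\<Sum>k<n * d. g (k div d) (k mod d)) = (\<Sum>x<n. \<Sum>w<d. g x w)"
proof (cases "d = 0")
  case False
  have "(\<Sum>k<n * d. g (k div d) (k mod d)) = (\<Sum>(x, w)\<in>{..<n} \<times> {..<d}. g x w)"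
    using False
    by (intro sum.reindex_bij_witness[of _ "\<lambda>(x, w). x * d + w" "\<lambda>k. (k div d, k mod d)"])
       (auto simp: less_mult_imp_div_less mult_add_less_mult)
  then show ?thesis by (simp add: sum.cartesian_product)
qed simp

lemma sum_fixed_mod:
  fixes g :: "nat \<Rightarrow> 'a::comm_monoid_add"
  assumes "w < d"
  shows "(\<Sum>k<n * d. if k mod d = w then g k else 0) = (\<Sum>x<n. g (x * d + w))"
proof -
  have "(\<Sum>k<n * d. if k mod d = w then g k else 0) =
    (\<Sum>k<n * d. if k mod d = w then g (k div d * d + w) else 0)"
    by (intro sum.cong) auto
  also have "\<dots> = (\<Sum>x<n. \<Sum>v<d. if v = w then g (x * d + w) else 0)"
    by (rule sum_div_mod[where g = "\<lambda>x v. if v = w then g (x * d + w) else 0"])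
  also have "\<dots> = (\<Sum>x<n. g (x * d + w))"
    using assms by simp
  finally show ?thesis .
qed

lemma ampliation_mult_index:
  assumes "X \<in> carrier_mat (n * d) m" "r < n * d" "c < m"
  shows "(ampliation n d A * X) $$ (r, c) = (\<Sum>x<n. A $$ (r div d, x) * X $$ (x * d + r mod d, c))"
proof -
  have d: "d > 0" using assms by (cases d) auto
  have "(ampliation n d A * X) $$ (r, c) =
    (\<Sum>k<n * d. if k mod d = r mod d then A $$ (r div d, k div d) * X $$ (k, c) else 0)"
    using assms by (auto simp: ampliation_def scalar_prod_def lessThan_atLeast0 intro!: sum.cong)
  also have "\<dots> = (\<Sum>x<n. A $$ (r div d, x) * X $$ (x * d + r mod d, c))"
    using d by (simp add: sum_fixed_mod)
  finally show ?thesis .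
qed

lemma mult_adjoint_ampliation_index:
  assumes "X \<in> carrier_mat m (n * d)" "r < m" "c < n * d"
  shows "(X * mat_adjoint (ampliation n d A)) $$ (r, c) =
    (\<Sum>y<n. X $$ (r, y * d + c mod d) * cnj (A $$ (c div d, y)))"
proof -
  have d: "d > 0" using assms by (cases d) auto
  have "(X * mat_adjoint (ampliation n d A)) $$ (r, c) =
    (\<Sum>k<n * d. X $$ (r, k) * cnj (ampliation n d A $$ (c, k)))"
    using assms adjoint_carrier[OF ampliation_carrier, of n d A]
    by (subst index_mult[of _ m "n * d"]) (auto intro!: sum.cong index_adjoint[OF ampliation_carrier])
  also have "\<dots> =
    (\<Sum>k<n * d. if k mod d = c mod d then X $$ (r, k) * cnj (A $$ (c div d, k div d)) else 0)"
    using assms by (auto simp: ampliation_def intro!: sum.cong)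
  also have "\<dots> = (\<Sum>y<n. X $$ (r, y * d + c mod d) * cnj (A $$ (c div d, y)))"
    using d by (simp add: sum_fixed_mod)
  finally show ?thesis .
qed

lemma tensor_id_oracle_channel:
  assumes A: "A \<in> carrier_mat n n" and S: "\<sigma> \<in> carrier_mat (n * d) (n * d)"
  shows "tensor_id n d (oracle_channel p A) \<sigma> =
    of_real p \<cdot>\<^sub>m (ampliation n d A * \<sigma> * mat_adjoint (ampliation n d A)) + of_real (1 - p) \<cdot>\<^sub>m \<sigma>"
proof (rule eq_matI)
  let ?B = "ampliation n d A"
  note adj = adjoint_carrier[OF ampliation_carrier, of n d A] adjoint_carrier[OF A]
  have c: "?B * \<sigma> * mat_adjoint ?B \<in> carrier_mat (n * d) (n * d)"
    using adj S by (intro mult_carrier_mat[of _ _ "n * d"]) auto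
  fix r c assume "r < dim_row (of_real p \<cdot>\<^sub>m (?B * \<sigma> * mat_adjoint ?B) + of_real (1 - p) \<cdot>\<^sub>m \<sigma>)"
    and "c < dim_col (of_real p \<cdot>\<^sub>m (?B * \<sigma> * mat_adjoint ?B) + of_real (1 - p) \<cdot>\<^sub>m \<sigma>)"
  then have rc: "r < n * d" "c < n * d" using S by auto
  then have d: "d > 0" by (cases d) auto
  have rc': "r div d < n" "c div d < n" using rc by (auto simp: less_mult_imp_div_less)
  have "(?B * \<sigma> * mat_adjoint ?B) $$ (r, c) =
     (\<Sum>y<n. (\<Sum>x<n. A $$ (r div d, x) * \<sigma> $$ (x * d + r mod d, y * d + c mod d)) * cnj (A $$ (c div d, y)))"
    using rc S d
    by (subst mult_adjoint_ampliation_index[of _ "n * d"])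
       (auto intro!: sum.cong ampliation_mult_index[of _ _ _ "n * d"] mult_carrier_mat[of _ _ "n * d"] simp: mult_add_less_mult simp del: index_mult_mat(1))
  moreover have "(A * mat n n (\<lambda>(x, y). \<sigma> $$ (x * d + r mod d, y * d + c mod d)) * mat_adjoint A) $$ (r div d, c div d) =
     (\<Sum>y<n. (\<Sum>x<n. A $$ (r div d, x) * \<sigma> $$ (x * d + r mod d, y * d + c mod d)) * cnj (A $$ (c div d, y)))"
    using rc' A by (simp add: index_sandwich[of _ n] del: index_mult_mat(1))
  ultimately show "tensor_id n d (oracle_channel p A) \<sigma> $$ (r, c) =
    (of_real p \<cdot>\<^sub>m (?B * \<sigma> * mat_adjoint ?B) + of_real (1 - p) \<cdot>\<^sub>m \<sigma>) $$ (r, c)"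
    using rc rc' A S c adj
    by (simp add: tensor_id_def oracle_channel_def del: index_mult_mat(1))
qed (use S in \<open>auto simp: tensor_id_def\<close>)

section \<open>Measurement of the index register\<close>

definition proj_first :: "nat \<Rightarrow> nat \<Rightarrow> nat \<Rightarrow> complex mat" where
  "proj_first D e i = mat D D (\<lambda>(r, c). if r = c \<and> r div e = i then 1 else 0)"

text \<open>The elements are diagonal 0/1 matrices, so their quadratic forms are sums of squared
  moduli, and each \<open>r < N * e\<close> lies in exactly one block
  \<open>r div e\<close>.\<close>

lemma proj_first_povm: "is_povm (N * e) N (proj_first (N * e) e)"
proof -
  have "is_psd (N * e) (proj_first (N * e) e j)" for j
    unfolding is_psd_def Let_def
  proof (intro conjI ballI)
    show "proj_first (N * e) e j \<in> carrier_mat (N * e) (N * e)" by (simp add: proj_first_def)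
    fix v :: "complex vec" assume v: "v \<in> carrier_vec (N * e)"
    have "conjugate v \<bullet> (proj_first (N * e) e j *\<^sub>v v) =
      (\<Sum>r = 0..<N * e. cnj (v $ r) * (\<Sum>c = 0..<N * e. if r = c then (if r div e = j then v $ c else 0) else 0))"
      using v by (auto simp: scalar_prod_def proj_first_def conjugate_complex_def if_distrib[of "\<lambda>z. z * _"]
        intro!: sum.cong cong: if_cong)
    also have "\<dots> = (\<Sum>r = 0..<N * e. of_real (if r div e = j then (cmod (v $ r))\<^sup>2 else 0))"
      by (intro sum.cong) (auto simp: complex_norm_square mult.commute simp del: of_real_power)
    finally have *: "conjugate v \<bullet> (proj_first (N * e) e j *\<^sub>v v) =
      of_real (\<Sum>r = 0..<N * e. if r div e = j then (cmod (v $ r))\<^sup>2 else 0)" by simp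
    show "Im (conjugate v \<bullet> (proj_first (N * e) e j *\<^sub>v v)) = 0"
      "Re (conjugate v \<bullet> (proj_first (N * e) e j *\<^sub>v v)) \<ge> 0"
      unfolding * by (auto intro!: sum_nonneg)
  qed
  moreover have "(\<Sum>j<N. proj_first (N * e) e j $$ (r, c)) = (1\<^sub>m (N * e)) $$ (r, c)"
    if "r < N * e" "c < N * e" for r c
    using that by (auto simp: proj_first_def less_mult_imp_div_less)
  ultimately show ?thesis by (simp add: is_povm_def)
qed

lemma mtrace_proj_first:
  assumes "X \<in> carrier_mat D D"
  shows "mtrace (proj_first D e i * X) = (\<Sum>r<D. if r div e = i then X $$ (r, r) else 0)"
proof -
  have "(proj_first D e i * X) $$ (r, r) = (if r div e = i then X $$ (r, r) else 0)" if "r < D" for r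
  proof -
    have "(proj_first D e i * X) $$ (r, r) =
      (\<Sum>c = 0..<D. if r = c then (if r div e = i then X $$ (c, r) else 0) else 0)"
      using that assms by (auto simp: proj_first_def scalar_prod_def if_distrib[of "\<lambda>z. z * _"]
        intro!: sum.cong cong: if_cong)
    then show ?thesis using that by simp
  qed
  then show ?thesis by (simp add: mtrace_def proj_first_def)
qed

lemma mtrace_proj_first_linear:
  assumes "X \<in> carrier_mat D D" "Y \<in> carrier_mat D D"
  shows "mtrace (proj_first D e i * (a \<cdot>\<^sub>m X + b \<cdot>\<^sub>m Y)) =
    a * mtrace (proj_first D e i * X) + b * mtrace (proj_first D e i * Y)"
proof -
  have "mtrace (proj_first D e i * (a \<cdot>\<^sub>m X + b \<cdot>\<^sub>m Y)) =
    (\<Sum>r<D. if r div e = i then (a \<cdot>\<^sub>m X + b \<cdot>\<^sub>m Y) $$ (r, r) else 0)"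
    using assms by (intro mtrace_proj_first) auto
  also have "\<dots> = (\<Sum>r<D. a * (if r div e = i then X $$ (r, r) else 0) + b * (if r div e = i then Y $$ (r, r) else 0))"
    using assms by (intro sum.cong) auto
  also have "\<dots> = a * mtrace (proj_first D e i * X) + b * mtrace (proj_first D e i * Y)"
    by (simp only: mtrace_proj_first[OF assms(1)] mtrace_proj_first[OF assms(2)] sum.distrib sum_distrib_left)
  finally show ?thesis .
qed

section \<open>Evolution under noisy queries, branch by branch\<close>

definition noisy_step :: "real \<Rightarrow> complex mat \<Rightarrow> complex mat \<Rightarrow> complex mat \<Rightarrow> complex mat" where
  "noisy_step p B U \<sigma> = of_real p \<cdot>\<^sub>m (B * (U * \<sigma> * mat_adjoint U) * mat_adjoint B)
     + of_real (1 - p) \<cdot>\<^sub>m (U * \<sigma> * mat_adjoint U)"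

lemma sandwich_carrier:
  "A \<in> carrier_mat n n \<Longrightarrow> X \<in> carrier_mat n n \<Longrightarrow> A * X * mat_adjoint A \<in> carrier_mat n n"
  by (auto intro!: mult_carrier_mat[of _ _ n])

lemma noisy_step_carrier:
  assumes "B \<in> carrier_mat n n" "U \<in> carrier_mat n n" "X \<in> carrier_mat n n"
  shows "noisy_step p B U X \<in> carrier_mat n n"
  using assms by (simp add: noisy_step_def sandwich_carrier)

lemma fold_noisy_step_carrier:
  assumes "B \<in> carrier_mat n n" "\<forall>U\<in>set Us. U \<in> carrier_mat n n" "X \<in> carrier_mat n n"
  shows "fold (noisy_step p B) Us X \<in> carrier_mat n n"
  using assms by (induction Us arbitrary: X) (auto intro!: noisy_step_carrier)

lemma noisy_step_linear:
  assumes "B \<in> carrier_mat n n" "U \<in> carrier_mat n n" "X \<in> carrier_mat n n" "Y \<in> carrier_mat n n"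
  shows "noisy_step p B U (a \<cdot>\<^sub>m X + b \<cdot>\<^sub>m Y) =
    a \<cdot>\<^sub>m noisy_step p B U X + b \<cdot>\<^sub>m noisy_step p B U Y"
proof -
  define X' Y' where "X' = U * X * mat_adjoint U" and "Y' = U * Y * mat_adjoint U"
  define X2 Y2 where "X2 = B * X' * mat_adjoint B" and "Y2 = B * Y' * mat_adjoint B"
  have c: "X' \<in> carrier_mat n n" "Y' \<in> carrier_mat n n" "X2 \<in> carrier_mat n n" "Y2 \<in> carrier_mat n n"
    unfolding X2_def Y2_def X'_def Y'_def using assms by (auto intro!: sandwich_carrier)
  have "noisy_step p B U (a \<cdot>\<^sub>m X + b \<cdot>\<^sub>m Y) =
    of_real p \<cdot>\<^sub>m (a \<cdot>\<^sub>m X2 + b \<cdot>\<^sub>m Y2) + of_real (1 - p) \<cdot>\<^sub>m (a \<cdot>\<^sub>m X' + b \<cdot>\<^sub>m Y')"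
    using assms c by (simp add: noisy_step_def sandwich_linear[of _ n] X2_def Y2_def flip: X'_def Y'_def)
  also have "\<dots> = a \<cdot>\<^sub>m (of_real p \<cdot>\<^sub>m X2 + of_real (1 - p) \<cdot>\<^sub>m X') + b \<cdot>\<^sub>m (of_real p \<cdot>\<^sub>m Y2 + of_real (1 - p) \<cdot>\<^sub>m Y')"
    using c by (intro eq_matI) (auto simp: algebra_simps)
  finally show ?thesis by (simp add: noisy_step_def X2_def Y2_def X'_def Y'_def)
qed

text \<open>Allows the mixture created by a query to be followed separately in its success and
  failure branches.\<close>

lemma fold_noisy_step_linear:
  assumes "B \<in> carrier_mat n n" "\<forall>U\<in>set Us. U \<in> carrier_mat n n" "X \<in> carrier_mat n n" "Y \<in> carrier_mat n n"
  shows "fold (noisy_step p B) Us (a \<cdot>\<^sub>m X + b \<cdot>\<^sub>m Y) =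
    a \<cdot>\<^sub>m fold (noisy_step p B) Us X + b \<cdot>\<^sub>m fold (noisy_step p B) Us Y"
  using assms
  by (induction Us arbitrary: X Y) (simp_all add: noisy_step_linear noisy_step_carrier)

lemma alg_final_state_eq_noisy_steps:
  assumes A: "A \<in> carrier_mat n n" and Us: "\<forall>U\<in>set Us. U \<in> carrier_mat (n * d) (n * d)"
    and "n * d > 0"
  shows "alg_final_state (n * d) (tensor_id n d (oracle_channel p A)) Us Uf =
    Uf * fold (noisy_step p (ampliation n d A)) Us (outer (unit_vec (n * d) 0)) * mat_adjoint Uf"
proof -
  have "fold (\<lambda>U \<sigma>. tensor_id n d (oracle_channel p A) (U * \<sigma> * mat_adjoint U)) Us X =
     fold (noisy_step p (ampliation n d A)) Us X" if "X \<in> carrier_mat (n * d) (n * d)" for X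
    using Us that
  proof (induction Us arbitrary: X)
    case (Cons U Us)
    then have "tensor_id n d (oracle_channel p A) (U * X * mat_adjoint U) = noisy_step p (ampliation n d A) U X"
      by (simp add: tensor_id_oracle_channel[OF A] sandwich_carrier noisy_step_def)
    with Cons show ?case by (simp add: noisy_step_carrier[of _ "n * d"])
  qed simp
  moreover have "mat (n * d) (n * d) (\<lambda>(r, c). if r = 0 \<and> c = 0 then 1 else 0) = outer (unit_vec (n * d) 0)"
    using assms(3) by (intro eq_matI) (auto simp: outer_def)
  ultimately show ?thesis by (simp add: alg_final_state_def)
qed

text \<open>The start matrix \<open>X\<close> is a parameter so that a recursion over the queries
  can restart from the state of either branch.\<close>

definition outcome_prob :: "nat \<Rightarrow> nat \<Rightarrow> nat \<Rightarrow> real \<Rightarrow> complex mat \<Rightarrow> complex mat list \<Rightarrow> complex mat \<Rightarrow> complex mat \<Rightarrow> real" where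
  "outcome_prob D e i p B Us Uf X =
     Re (mtrace (proj_first D e i * (Uf * fold (noisy_step p B) Us X * mat_adjoint Uf)))"

lemma outcome_prob_Nil:
  assumes "Uf \<in> carrier_mat D D" "v \<in> carrier_vec D"
  shows "outcome_prob D e i p B [] Uf (outer v) =
    (\<Sum>r<D. if r div e = i then (cmod ((Uf *\<^sub>v v) $ r))\<^sup>2 else 0)"
proof -
  have "mtrace (proj_first D e i * outer (Uf *\<^sub>v v)) =
    (\<Sum>r<D. if r div e = i then outer (Uf *\<^sub>v v) $$ (r, r) else 0)"
    using assms by (intro mtrace_proj_first) simp
  also have "\<dots> = of_real (\<Sum>r<D. if r div e = i then (cmod ((Uf *\<^sub>v v) $ r))\<^sup>2 else 0)"
    unfolding of_real_sum using assms
    by (intro sum.cong) (auto simp: outer_def complex_norm_square simp del: of_real_power index_mult_mat_vec)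
  finally show ?thesis
    using assms by (simp add: outcome_prob_def sandwich_outer)
qed

text \<open>A query turns a pure state into a mixture of two pure states, and the rest is linear;
  this is the recursion of \<open>hit_prob\<close>.\<close>

lemma outcome_prob_Cons:
  assumes "B \<in> carrier_mat D D" "U \<in> carrier_mat D D" "\<forall>U\<in>set Us. U \<in> carrier_mat D D"
    "Uf \<in> carrier_mat D D" "v \<in> carrier_vec D"
  shows "outcome_prob D e i p B (U # Us) Uf (outer v) =
    p * outcome_prob D e i p B Us Uf (outer (B *\<^sub>v (U *\<^sub>v v))) +
    (1 - p) * outcome_prob D e i p B Us Uf (outer (U *\<^sub>v v))"
proof -
  define X where "X = fold (noisy_step p B) Us (outer (B *\<^sub>v (U *\<^sub>v v)))"
  define Y where "Y = fold (noisy_step p B) Us (outer (U *\<^sub>v v))"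
  have c: "X \<in> carrier_mat D D" "Y \<in> carrier_mat D D"
    unfolding X_def Y_def using assms by (auto intro!: fold_noisy_step_carrier)
  note c' = sandwich_carrier[OF assms(4) c(1)] sandwich_carrier[OF assms(4) c(2)]
  have "noisy_step p B U (outer v) = of_real p \<cdot>\<^sub>m outer (B *\<^sub>v (U *\<^sub>v v)) + of_real (1 - p) \<cdot>\<^sub>m outer (U *\<^sub>v v)"
    using assms by (simp add: noisy_step_def sandwich_outer[of _ D])
  then have "Uf * fold (noisy_step p B) (U # Us) (outer v) * mat_adjoint Uf =
    of_real p \<cdot>\<^sub>m (Uf * X * mat_adjoint Uf) + of_real (1 - p) \<cdot>\<^sub>m (Uf * Y * mat_adjoint Uf)"
    using assms c by (simp add: fold_noisy_step_linear[of _ D] sandwich_linear[of _ D] flip: X_def Y_def)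
  then show ?thesis
    using mtrace_proj_first_linear[OF c', of e i "of_real p" "of_real (1 - p)"]
    by (simp add: outcome_prob_def X_def Y_def)
qed

subsection \<open>The search circuit\<close>

text \<open>
  On \<open>\<H>\<^sub>A \<otimes> \<complex>\<^sup>2 \<otimes> \<complex>\<^sup>d\<close> the basis vector \<open>|j\<rangle>|b\<rangle>|w\<rangle>\<close> has index \<open>(2 * j + b) * d + w = j * e + u\<close>
  with \<open>e = 2 * d\<close> and \<open>u = b * d + w\<close>.
\<close>
definition amp_state :: "nat \<Rightarrow> nat \<Rightarrow> (nat \<Rightarrow> real) \<Rightarrow> nat \<Rightarrow> complex vec" where
  "amp_state N e a u = vec (N * e) (\<lambda>r. if r mod e = u then of_real (a (r div e)) else 0)"

lemma amp_state_carrier [simp]: "amp_state N e a u \<in> carrier_vec (N * e)"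
  by (simp add: amp_state_def)

lemma amp_state_outcome:
  assumes "i < N" "u < e"
  shows "(\<Sum>r<N * e. if r div e = i then (cmod (amp_state N e a u $ r))\<^sup>2 else 0) = (a i)\<^sup>2"
proof -
  have "(\<Sum>r<N * e. if r div e = i then (cmod (amp_state N e a u $ r))\<^sup>2 else 0) =
    (\<Sum>r<N * e. if r mod e = u then (if r div e = i then (a i)\<^sup>2 else 0) else 0)"
    by (intro sum.cong) (auto simp: amp_state_def)
  also have "\<dots> = (\<Sum>j<N. if j = i then (a i)\<^sup>2 else 0)"
    using assms by (simp add: sum_fixed_mod)
  finally show ?thesis using assms by simp
qed

section \<open>Controlled reflections and their action on amplitudes\<close>

definition refl_entry :: "(nat \<Rightarrow> real) \<Rightarrow> bool \<Rightarrow> nat \<Rightarrow> nat \<Rightarrow> real" where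
  "refl_entry f b j l = (if b then 2 * f j * f l - of_bool (j = l) else of_bool (j = l))"

text \<open>Applies the reflection in \<open>f\<close> to the index register if the remaining
  registers hold a \<open>u\<close> in \<open>C\<close>, and replaces \<open>u\<close> by
  \<open>\<pi> u\<close>. State preparation and Grover step are both of this form.\<close>

definition ctrl_reflect :: "nat \<Rightarrow> nat \<Rightarrow> (nat \<Rightarrow> real) \<Rightarrow> (nat \<Rightarrow> nat) \<Rightarrow> nat set \<Rightarrow> complex mat" where
  "ctrl_reflect N e f \<pi> C = mat (N * e) (N * e) (\<lambda>(r, c). if r mod e = \<pi> (c mod e)
     then of_real (refl_entry f (c mod e \<in> C) (r div e) (c div e)) else 0)"

lemma ctrl_reflect_carrier [simp]: "ctrl_reflect N e f \<pi> C \<in> carrier_mat (N * e) (N * e)"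
  by (simp add: ctrl_reflect_def)

lemma dim_ctrl_reflect [simp]:
  "dim_row (ctrl_reflect N e f \<pi> C) = N * e" "dim_col (ctrl_reflect N e f \<pi> C) = N * e"
  by (simp_all add: ctrl_reflect_def)

text \<open>For the reflection, the cross terms contribute \<open>4 - 2 - 2\<close> times
  \<open>f l * f l'\<close>, using that \<open>f\<close> is a unit vector.\<close>

lemma refl_entry_orthogonal:
  assumes "(\<Sum>j<N. (f j)\<^sup>2) = 1" "l < N" "l' < N"
  shows "(\<Sum>j<N. refl_entry f b j l * refl_entry f b j l') = of_bool (l = l')"
proof (cases b)
  case True
  have "(\<Sum>j<N. refl_entry f b j l * refl_entry f b j l') =
    (\<Sum>j<N. 4 * f l * f l' * (f j)\<^sup>2 - (if j = l then 2 * f l * f l' else 0)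
        - (if j = l' then 2 * f l * f l' else 0) + (if j = l then of_bool (l = l') else 0))"
    using True by (intro sum.cong) (auto simp: refl_entry_def power2_eq_square algebra_simps)
  also have "\<dots> = of_bool (l = l')"
    using assms by (simp add: sum.distrib sum_subtractf sum_distrib_left[symmetric])
  finally show ?thesis .
next
  case False
  have "(\<Sum>j<N. refl_entry f b j l * refl_entry f b j l') = (\<Sum>j<N. if j = l then of_bool (l = l') else 0)"
    using False by (intro sum.cong) (auto simp: refl_entry_def)
  then show ?thesis using assms by simp
qed

text \<open>Columns with different \<open>u\<close> have disjoint supports as \<open>\<pi>\<close>
  is injective; those with equal \<open>u\<close> are handled by
  \<open>refl_entry_orthogonal\<close>.\<close>

lemma ctrl_reflect_unitary:
  assumes f: "(\<Sum>j<N. (f j)\<^sup>2) = 1" and inj: "inj_on \<pi> {..<e}" and \<pi>: "\<And>u. u < e \<Longrightarrow> \<pi> u < e"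
  shows "is_unitary (N * e) (ctrl_reflect N e f \<pi> C)"
proof -
  let ?W = "ctrl_reflect N e f \<pi> C"
  note adj = adjoint_carrier[OF ctrl_reflect_carrier[of N e f \<pi> C]]
  have "mat_adjoint ?W * ?W = 1\<^sub>m (N * e)"
  proof (rule eq_matI)
    fix r c assume "r < dim_row (1\<^sub>m (N * e) :: complex mat)" "c < dim_col (1\<^sub>m (N * e) :: complex mat)"
    then have rc: "r < N * e" "c < N * e" by auto
    then have e: "e > 0" by (cases e) auto
    let ?u = "r mod e" and ?v = "c mod e"
    have uv: "?u < e" "?v < e" "\<pi> ?u < e" using e \<pi> by auto
    have "(mat_adjoint ?W * ?W) $$ (r, c) = (\<Sum>k<N * e. cnj (?W $$ (k, r)) * ?W $$ (k, c))"
      using rc adj by (subst index_mult[of _ "N * e" "N * e" _ "N * e"])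
        (auto intro!: sum.cong index_adjoint[OF ctrl_reflect_carrier])
    also have "\<dots> = (\<Sum>k<N * e. if k mod e = \<pi> ?u then (if \<pi> ?u = \<pi> ?v then
        of_real (refl_entry f (?u \<in> C) (k div e) (r div e) * refl_entry f (?v \<in> C) (k div e) (c div e)) else 0) else 0)"
      using rc by (intro sum.cong) (auto simp: ctrl_reflect_def)
    also have "\<dots> = (\<Sum>j<N. if \<pi> ?u = \<pi> ?v then
        of_real (refl_entry f (?u \<in> C) j (r div e) * refl_entry f (?v \<in> C) j (c div e)) else 0)"
      using uv e by (simp add: sum_fixed_mod cong: if_cong)
    also have "\<dots> = (if ?u = ?v then
        of_real (\<Sum>j<N. refl_entry f (?u \<in> C) j (r div e) * refl_entry f (?u \<in> C) j (c div e)) else 0)"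
    proof -
      have "\<pi> ?u = \<pi> ?v \<longleftrightarrow> ?u = ?v" using inj uv by (simp add: inj_on_eq_iff)
      then show ?thesis by simp
    qed
    also have "\<dots> = (if ?u = ?v then of_bool (r div e = c div e) else 0)"
      using rc f by (simp add: refl_entry_orthogonal less_mult_imp_div_less del: of_real_sum)
    also have "\<dots> = 1\<^sub>m (N * e) $$ (r, c)"
      using rc by (auto simp: of_bool_def) (metis mod_div_decomp)
    finally show "(mat_adjoint ?W * ?W) $$ (r, c) = 1\<^sub>m (N * e) $$ (r, c)" .
  qed (use adj in auto)
  moreover from this have "?W * mat_adjoint ?W = 1\<^sub>m (N * e)"
    using adj by (intro mat_mult_left_right_inverse[of "mat_adjoint ?W" "N * e"]) auto
  ultimately show ?thesis by (simp add: is_unitary_def)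
qed

lemma ctrl_reflect_amp_state:
  assumes "u < e"
  shows "ctrl_reflect N e f \<pi> C *\<^sub>v amp_state N e a u =
    amp_state N e (if u \<in> C then reflect N f a else a) (\<pi> u)"
proof (rule eq_vecI)
  fix r assume "r < dim_vec (amp_state N e (if u \<in> C then reflect N f a else a) (\<pi> u))"
  then have r: "r < N * e" by (simp add: amp_state_def)
  then have rN: "r div e < N" by (rule less_mult_imp_div_less)
  have "(ctrl_reflect N e f \<pi> C *\<^sub>v amp_state N e a u) $ r =
    (\<Sum>k<N * e. ctrl_reflect N e f \<pi> C $$ (r, k) * amp_state N e a u $ k)"
    using r by (intro index_mult_vec) auto
  also have "\<dots> = (\<Sum>k<N * e. if k mod e = u then (if r mod e = \<pi> u then
      of_real (refl_entry f (u \<in> C) (r div e) (k div e) * a (k div e)) else 0) else 0)"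
    using r by (intro sum.cong) (auto simp: ctrl_reflect_def amp_state_def)
  also have "\<dots> = (if r mod e = \<pi> u then
      of_real (\<Sum>l<N. refl_entry f (u \<in> C) (r div e) l * a l) else 0)"
    using assms by (simp add: sum_fixed_mod)
  also have "(\<Sum>l<N. refl_entry f (u \<in> C) (r div e) l * a l) =
    (if u \<in> C then reflect N f a else a) (r div e)"
  proof (cases "u \<in> C")
    case True
    have "(\<Sum>l<N. refl_entry f True (r div e) l * a l) =
      (\<Sum>l<N. 2 * f (r div e) * (f l * a l) - (if l = r div e then a l else 0))"
      by (intro sum.cong) (auto simp: refl_entry_def algebra_simps)
    then show ?thesis using True rN by (simp add: reflect_def sum_subtractf sum_distrib_left)
  next
    case False
    have "(\<Sum>l<N. refl_entry f False (r div e) l * a l) = (\<Sum>l<N. if l = r div e then a l else 0)"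
      by (intro sum.cong) (auto simp: refl_entry_def)
    then show ?thesis using False rN by simp
  qed
  finally show "(ctrl_reflect N e f \<pi> C *\<^sub>v amp_state N e a u) $ r =
    amp_state N e (if u \<in> C then reflect N f a else a) (\<pi> u) $ r"
    using r by (simp add: amp_state_def)
qed (simp add: amp_state_def ctrl_reflect_def)

text \<open>The oracle is specified only on qubit value \<open>0\<close>. This suffices because
  \<open>h < d\<close> encodes qubit \<open>0\<close>, and the output label \<open>d + h\<close>
  encodes qubit \<open>1\<close>.\<close>

lemma oracle_amp_state:
  assumes Or: "Or \<in> carrier_mat (2 * N) (2 * N)"
    and col: "\<And>j. j < N \<Longrightarrow> Or *\<^sub>v unit_vec (2 * N) (2 * j) =
            (if j = i then -1 else 1) \<cdot>\<^sub>v unit_vec (2 * N) (2 * j + 1)"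
    and h: "h < d"
  shows "ampliation (2 * N) d Or *\<^sub>v amp_state N (2 * d) a h = amp_state N (2 * d) (flip i a) (d + h)"
proof (rule eq_vecI)
  have D: "N * (2 * d) = 2 * N * d" by simp
  fix r assume "r < dim_vec (amp_state N (2 * d) (flip i a) (d + h))"
  then have r: "r < 2 * N * d" by (simp add: amp_state_def)
  define R w where "R = r div d" and "w = r mod d"
  have RN: "R < 2 * N" unfolding R_def using r by (rule less_mult_imp_div_less)
  have w: "w < d" using h by (simp add: w_def)
  \<comment> \<open>Translates between the groupings \<open>(2 * N) * d\<close> and
    \<open>N * (2 * d)\<close>: here \<open>x = 2 * j + b\<close> joins index and qubit.\<close>
  have md: "(x * d + v) mod (2 * d) = d * (x mod 2) + v" "(x * d + v) div (2 * d) = x div 2"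
    if "v < d" for x v
    using that mod_mult2_eq[of "x * d + v" d 2] div_mult2_eq[of "x * d + v" d 2]
    by (auto simp: mult.commute)
  have ent: "Or $$ (R, j * 2) = (if R = 2 * j + 1 then (if j = i then -1 else 1) else 0)" if "j < N" for j
  proof -
    have "(Or *\<^sub>v unit_vec (2 * N) (2 * j)) $ R = (\<Sum>l<2 * N. Or $$ (R, l) * unit_vec (2 * N) (2 * j) $ l)"
      using Or RN by (intro index_mult_vec) auto
    also have "\<dots> = (\<Sum>l<2 * N. if l = 2 * j then Or $$ (R, l) else 0)"
      using that by (intro sum.cong) auto
    also have "\<dots> = Or $$ (R, j * 2)" using that by (simp add: mult.commute)
    finally show ?thesis using col[OF that] RN that
      by (cases "j = i"; cases "R = 2 * j + 1") (auto simp: mult.commute)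
  qed
  have "(ampliation (2 * N) d Or *\<^sub>v amp_state N (2 * d) a h) $ r =
    (\<Sum>k<2 * N * d. ampliation (2 * N) d Or $$ (r, k) * amp_state N (2 * d) a h $ k)"
    using r by (intro index_mult_vec) (auto simp flip: D)
  also have "\<dots> = (\<Sum>k<2 * N * d. if k mod d = w then Or $$ (R, k div d) * amp_state N (2 * d) a h $ k else 0)"
    using r by (intro sum.cong) (auto simp: ampliation_def R_def w_def)
  also have "\<dots> = (\<Sum>x<2 * N. Or $$ (R, x) * amp_state N (2 * d) a h $ (x * d + w))"
    using w by (simp add: sum_fixed_mod)
  \<comment> \<open>Only even \<open>x\<close>, that is qubit \<open>0\<close>, carry amplitude,
    which makes this a \<open>sum_fixed_mod\<close> with modulus 2.\<close>
  also have "\<dots> = (\<Sum>x<N * 2. if x mod 2 = 0 then (if w = h then Or $$ (R, x) * of_real (a (x div 2)) else 0) else 0)"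
  proof (intro sum.cong)
    fix x assume x: "x \<in> {..<N * 2}"
    then have "x * d + w < N * (2 * d)" using mult_add_less_mult[of x "2 * N" w d] w by (simp add: D)
    then show "Or $$ (R, x) * amp_state N (2 * d) a h $ (x * d + w) =
      (if x mod 2 = 0 then (if w = h then Or $$ (R, x) * of_real (a (x div 2)) else 0) else 0)"
      using w h by (cases "x mod 2 = 0") (auto simp: amp_state_def md)
  qed auto
  also have "\<dots> = (\<Sum>j<N. if w = h then Or $$ (R, j * 2) * of_real (a j) else 0)"
    by (subst sum_fixed_mod) (simp_all cong: if_cong)
  also have "\<dots> = (\<Sum>j<N. if j = R div 2 then (if w = h \<and> R mod 2 = 1 then of_real (flip i a j) else 0) else 0)"
  proof (intro sum.cong)
    fix j assume "j \<in> {..<N}"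
    moreover have "R = 2 * j + 1 \<longleftrightarrow> j = R div 2 \<and> R mod 2 = 1" by presburger
    ultimately show "(if w = h then Or $$ (R, j * 2) * of_real (a j) else 0) =
      (if j = R div 2 then (if w = h \<and> R mod 2 = 1 then of_real (flip i a j) else 0) else 0 :: complex)"
      by (auto simp: ent flip_def)
  qed auto
  also have "\<dots> = (if w = h \<and> R mod 2 = 1 then of_real (flip i a (R div 2)) else 0)"
    using RN by auto
  also have "\<dots> = amp_state N (2 * d) (flip i a) (d + h) $ r"
  proof -
    have "r = R * d + w" by (simp add: R_def w_def)
    then have "r mod (2 * d) = d * (R mod 2) + w" "r div (2 * d) = R div 2" using md w by auto
    moreover have "d * (R mod 2) + w = d + h \<longleftrightarrow> w = h \<and> R mod 2 = 1"
      using w h by (cases "R mod 2 = 0") auto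
    ultimately show ?thesis using r by (simp add: amp_state_def)
  qed
  finally show "(ampliation (2 * N) d Or *\<^sub>v amp_state N (2 * d) a h) $ r =
    amp_state N (2 * d) (flip i a) (d + h) $ r" .
qed (simp add: amp_state_def ampliation_def)

text \<open>
  For \<open>d\<close> a power of two this is the cyclic bit rotation of \<open>u = b * d + w\<close>: it appends the
  outcome \<open>b\<close> of the last query to the history \<open>w\<close> and puts a fresh zero in its place.
\<close>
definition rot :: "nat \<Rightarrow> nat \<Rightarrow> nat" where
  "rot d u = (if u < d then 2 * u else 2 * (u - d) + 1)"

lemma inj_on_rot: "inj_on (rot d) {..<2 * d}"
  by (rule inj_on_inverseI[where g = "\<lambda>v. if even v then v div 2 else v div 2 + d"]) (auto simp: rot_def)

lemma rot_less: "u < 2 * d \<Longrightarrow> rot d u < 2 * d"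
  by (auto simp: rot_def)

text \<open>The control set is shifted by \<open>d\<close>, so the diffusion runs exactly when the
  last query succeeded and the earlier history lies in \<open>C\<close>.\<close>

definition grover_step :: "nat \<Rightarrow> nat \<Rightarrow> nat set \<Rightarrow> complex mat" where
  "grover_step N d C = ctrl_reflect N (2 * d) (uniform_amp N) (rot d) ((+) d ` C)"

lemma grover_step_carrier [simp]: "grover_step N d C \<in> carrier_mat (N * (2 * d)) (N * (2 * d))"
  by (simp add: grover_step_def)

lemma sum_uniform_amp: "N > 0 \<Longrightarrow> (\<Sum>j<N. (uniform_amp N j)\<^sup>2) = 1"
  by (simp add: uniform_amp_def power_divide)

lemma grover_step_unitary: "N > 0 \<Longrightarrow> is_unitary (N * (2 * d)) (grover_step N d C)"
  unfolding grover_step_def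
  by (intro ctrl_reflect_unitary sum_uniform_amp inj_on_rot rot_less)

lemma grover_step_failure:
  assumes "h < d"
  shows "grover_step N d C *\<^sub>v amp_state N (2 * d) a h = amp_state N (2 * d) a (2 * h)"
proof -
  have "h \<notin> (+) d ` C" using assms by auto
  then show ?thesis
    using assms by (simp add: grover_step_def ctrl_reflect_amp_state rot_def)
qed

lemma grover_step_success:
  assumes "h < d"
  shows "grover_step N d C *\<^sub>v amp_state N (2 * d) a (d + h) =
    amp_state N (2 * d) (if h \<in> C then reflect N (uniform_amp N) a else a) (2 * h + 1)"
proof -
  have "d + h \<in> (+) d ` C \<longleftrightarrow> h \<in> C" by auto
  then show ?thesis
    using assms by (simp add: grover_step_def ctrl_reflect_amp_state rot_def)
qed

text \<open>Here \<open>v\<close> is the state just before a Grover step, since each round applies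
  its unitary before its query and the circuit ends with one more step. The bound on
  \<open>h\<close> reserves room for \<open>n\<close> further history bits.\<close>

lemma outcome_prob_grover:
  fixes N d i :: nat and Or
  defines "D \<equiv> N * (2 * d)" and "B \<equiv> ampliation (2 * N) d Or"
  assumes Or: "Or \<in> carrier_mat (2 * N) (2 * N)"
    and col: "\<And>j. j < N \<Longrightarrow> Or *\<^sub>v unit_vec (2 * N) (2 * j) =
            (if j = i then -1 else 1) \<cdot>\<^sub>v unit_vec (2 * N) (2 * j + 1)"
    and i: "i < N"
    and v: "v \<in> carrier_vec D" "grover_step N d C *\<^sub>v v = amp_state N (2 * d) a h"
    and h: "(h + 1) * 2 ^ n \<le> d"
  shows "outcome_prob D (2 * d) i p B (replicate n (grover_step N d C)) (grover_step N d C) (outer v) =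
    hit_prob N p C i n a h"
  using v h
proof (induction n arbitrary: v a h)
  case 0
  have "outcome_prob D (2 * d) i p B [] (grover_step N d C) (outer v) =
    (\<Sum>r<D. if r div (2 * d) = i then (cmod ((grover_step N d C *\<^sub>v v) $ r))\<^sup>2 else 0)"
    using 0 by (intro outcome_prob_Nil) (auto simp: D_def)
  also have "\<dots> = (a i)\<^sup>2"
    unfolding 0(2) D_def using 0 by (intro amp_state_outcome i) auto
  finally show ?case by simp
next
  case (Suc n)
  have B: "B \<in> carrier_mat D D"
    using ampliation_carrier[of "2 * N" d Or] by (simp add: D_def B_def mult_ac)
  have W: "grover_step N d C \<in> carrier_mat D D" by (simp add: D_def)
  have "1 * (h + 1) \<le> 2 ^ Suc n * (h + 1)" by (intro mult_le_mono1) simp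
  then have hd: "h < d" using Suc.prems(3) by (simp add: mult.commute)
  \<comment> \<open>Appending a success costs exactly one bit of room:
    \<open>(2 * h + 2) * 2 ^ n = (h + 1) * 2 ^ Suc n\<close>.\<close>
  have le: "(2 * h + 1 + 1) * 2 ^ n \<le> d" "(2 * h + 1) * 2 ^ n \<le> d"
    using Suc.prems(3) by (auto simp: algebra_simps)
  have amp: "amp_state N (2 * d) a' u \<in> carrier_vec D" for a' u by (simp add: D_def)
  have "outcome_prob D (2 * d) i p B (replicate (Suc n) (grover_step N d C)) (grover_step N d C) (outer v) =
    p * outcome_prob D (2 * d) i p B (replicate n (grover_step N d C)) (grover_step N d C)
          (outer (amp_state N (2 * d) (flip i a) (d + h))) +
    (1 - p) * outcome_prob D (2 * d) i p B (replicate n (grover_step N d C)) (grover_step N d C)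
          (outer (amp_state N (2 * d) a h))"
    using outcome_prob_Cons[OF B W _ W Suc.prems(1), of "replicate n (grover_step N d C)" "2 * d" i p] W
      oracle_amp_state[OF Or col hd, of a] Suc.prems(2)
    by (simp add: B_def)
  also have "\<dots> = hit_prob N p C i (Suc n) a h"
    using Suc.IH[OF amp grover_step_success[OF hd] le(1)] Suc.IH[OF amp grover_step_failure[OF hd] le(2)]
    by simp
  finally show ?case .
qed

text \<open>The bisector of \<open>|0\<rangle>\<close> and the uniform state; reflecting in it exchanges the two.\<close>
definition prep_axis :: "nat \<Rightarrow> nat \<Rightarrow> real" where
  "prep_axis N j = (of_bool (j = 0) + uniform_amp N j) / sqrt (2 + 2 / sqrt N)"

text \<open>The vector \<open>|0>\<close> plus the uniform state has squared norm
  \<open>1 + 1 + 2 / sqrt N\<close>.\<close>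

lemma sum_prep_axis:
  assumes "N > 0"
  shows "(\<Sum>j<N. (prep_axis N j)\<^sup>2) = 1"
proof -
  have pos: "2 + 2 / sqrt N > 0" by (intro add_pos_nonneg) auto
  have "(\<Sum>j<N. (of_bool (j = 0) + uniform_amp N j)\<^sup>2) =
    (\<Sum>j<N. (if j = 0 then 1 + 2 / sqrt N else 0) + (uniform_amp N j)\<^sup>2)"
    by (intro sum.cong) (auto simp: uniform_amp_def power2_eq_square algebra_simps)
  also have "\<dots> = 2 + 2 / sqrt N"
    using assms by (simp add: sum.distrib sum_uniform_amp)
  finally show ?thesis
    using pos by (simp add: prep_axis_def power_divide flip: sum_divide_distrib)
qed

lemma reflect_prep_axis:
  assumes "N > 0"
  shows "reflect N (prep_axis N) (\<lambda>j. of_bool (j = 0)) = uniform_amp N"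
proof
  fix j
  define s where "s = 1 / sqrt (real N)"
  have s: "s \<ge> 0" by (simp add: s_def)
  have "(\<Sum>l<N. prep_axis N l * of_bool (l = 0)) = (\<Sum>l<N. if l = 0 then prep_axis N 0 else 0)"
    by (intro sum.cong) auto
  also have "\<dots> = (1 + s) / sqrt (2 + 2 * s)"
    using assms by (simp add: prep_axis_def uniform_amp_def s_def)
  finally have "reflect N (prep_axis N) (\<lambda>j. of_bool (j = 0)) j =
    2 * prep_axis N j * ((1 + s) / sqrt (2 + 2 * s)) - of_bool (j = 0)"
    by (simp only: reflect_def)
  also have "prep_axis N j = (of_bool (j = 0) + s) / sqrt (2 + 2 * s)"
    by (simp add: prep_axis_def uniform_amp_def s_def)
  also have "2 * ((of_bool (j = 0) + s) / sqrt (2 + 2 * s)) * ((1 + s) / sqrt (2 + 2 * s)) - of_bool (j = 0)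
    = (of_bool (j = 0) + s) * (2 + 2 * s) / (sqrt (2 + 2 * s))\<^sup>2 - of_bool (j = 0)"
    by (simp add: power2_eq_square algebra_simps)
  also have "\<dots> = s" using s by simp
  finally show "reflect N (prep_axis N) (\<lambda>j. of_bool (j = 0)) j = uniform_amp N j"
    by (simp add: s_def uniform_amp_def)
qed

text \<open>One circuit and one measurement serve all \<open>i\<close>, and the success probability
  is computed exactly for an arbitrary diffusion rule \<open>C\<close>.\<close>

lemma noisy_search:
  fixes N T :: nat and p :: real and Or :: "nat \<Rightarrow> complex mat"
  assumes N: "N > 0" and T: "T > 0"
    and Or: "\<And>i. i < N \<Longrightarrow> Or i \<in> carrier_mat (2 * N) (2 * N)"
    and col: "\<And>i j. i < N \<Longrightarrow> j < N \<Longrightarrow> Or i *\<^sub>v unit_vec (2 * N) (2 * j) =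
            (if j = i then -1 else 1) \<cdot>\<^sub>v unit_vec (2 * N) (2 * j + 1)"
  shows "\<exists>(d::nat) Us Uf M. d \<ge> 1 \<and> length Us = T \<and>
           (\<forall>U \<in> set Us. is_unitary (2*N*d) U) \<and> is_unitary (2*N*d) Uf \<and>
           is_povm (2*N*d) N M \<and>
           (\<forall>i<N. Re (mtrace (M i * alg_final_state (2*N*d)
                      (tensor_id (2*N) d (oracle_channel p (Or i))) Us Uf)) =
              hit_prob N p C i T (uniform_amp N) 0)"
proof -
  define d :: nat where "d = 2 ^ T"
  define D where "D = N * (2 * d)"
  define P where "P = ctrl_reflect N (2 * d) (prep_axis N) id UNIV"
  define W where "W = grover_step N d C"
  \<comment> \<open>The first query is preceded by the preparation, the others by \<open>W\<close>.
    With \<open>W\<close> also as final unitary, every query is followed by a Grover step.\<close>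
  define Us where "Us = P # replicate (T - 1) W"
  have D: "2 * N * d = D" by (simp add: D_def)
  have d: "d > 0" by (simp add: d_def)
  have P: "is_unitary D P"
    unfolding P_def D_def by (intro ctrl_reflect_unitary sum_prep_axis N) auto
  have W: "is_unitary D W" unfolding W_def D_def using N by (rule grover_step_unitary)
  have PC: "P \<in> carrier_mat D D" and WC: "W \<in> carrier_mat D D"
    using P W by (auto simp: is_unitary_def)
  have U: "\<forall>U\<in>set Us. is_unitary D U" using P W by (auto simp: Us_def)
  then have UC: "\<forall>U\<in>set Us. U \<in> carrier_mat D D" by (auto simp: is_unitary_def)
  have init: "unit_vec D 0 = amp_state N (2 * d) (\<lambda>j. of_bool (j = 0)) 0"
  proof (rule eq_vecI)
    fix r assume "r < dim_vec (amp_state N (2 * d) (\<lambda>j. of_bool (j = 0)) 0)"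
    then have r: "r < D" by (simp add: amp_state_def D_def)
    have "r = 0 \<longleftrightarrow> r mod (2 * d) = 0 \<and> r div (2 * d) = 0"
      by (metis div_0 mod_0 div_mult_mod_eq mult_0 add_0)
    with r show "unit_vec D 0 $ r = amp_state N (2 * d) (\<lambda>j. of_bool (j = 0)) 0 $ r"
      by (simp add: amp_state_def unit_vec_def of_bool_def flip: D_def)
  qed (simp add: amp_state_def D_def)
  have prep: "P *\<^sub>v unit_vec D 0 = amp_state N (2 * d) (uniform_amp N) 0"
    unfolding init P_def using d N
    by (subst ctrl_reflect_amp_state) (auto simp: reflect_prep_axis)
  have "Re (mtrace (proj_first D (2 * d) i * alg_final_state D
       (tensor_id (2 * N) d (oracle_channel p (Or i))) Us W)) = hit_prob N p C i T (uniform_amp N) 0"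
    if i: "i < N" for i
  proof -
    define B where "B = ampliation (2 * N) d (Or i)"
    have BC: "B \<in> carrier_mat D D" unfolding B_def D[symmetric] by simp
    obtain m where m: "T = Suc m" using T by (cases T) auto
    have hd: "0 < d" "(0 + 1 + 1) * 2 ^ m \<le> d" "(0 + 1) * 2 ^ m \<le> d"
      by (auto simp: d_def m)
    have col': "\<And>j. j < N \<Longrightarrow> Or i *\<^sub>v unit_vec (2 * N) (2 * j) =
            (if j = i then -1 else 1) \<cdot>\<^sub>v unit_vec (2 * N) (2 * j + 1)" using col i by blast
    have "alg_final_state D (tensor_id (2 * N) d (oracle_channel p (Or i))) Us W =
      W * fold (noisy_step p B) Us (outer (unit_vec D 0)) * mat_adjoint W"
      using alg_final_state_eq_noisy_steps[OF Or[OF i], of Us d p W] UC N d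
      by (simp add: D B_def) (simp add: D_def)
    then have "Re (mtrace (proj_first D (2 * d) i * alg_final_state D
       (tensor_id (2 * N) d (oracle_channel p (Or i))) Us W)) =
       outcome_prob D (2 * d) i p B Us W (outer (unit_vec D 0))"
      by (simp add: outcome_prob_def)
    also have "\<dots> = p * outcome_prob D (2 * d) i p B (replicate m W) W
            (outer (amp_state N (2 * d) (flip i (uniform_amp N)) (d + 0)))
      + (1 - p) * outcome_prob D (2 * d) i p B (replicate m W) W
            (outer (amp_state N (2 * d) (uniform_amp N) 0))"
      using outcome_prob_Cons[OF BC PC _ WC, of "replicate m W" "unit_vec D 0" "2 * d" i p] WC
        oracle_amp_state[OF Or[OF i] col' hd(1), of "uniform_amp N"]
      by (simp add: Us_def m prep B_def)
    also have "\<dots> = hit_prob N p C i T (uniform_amp N) 0"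
    proof -
      have "outcome_prob D (2 * d) i p B (replicate m W) W
            (outer (amp_state N (2 * d) (flip i (uniform_amp N)) (d + 0))) =
          hit_prob N p C i m (if 0 \<in> C then reflect N (uniform_amp N) (flip i (uniform_amp N))
            else flip i (uniform_amp N)) (2 * 0 + 1)"
        unfolding D_def B_def W_def using hd
        by (intro outcome_prob_grover Or col' i amp_state_carrier grover_step_success) auto
      moreover have "outcome_prob D (2 * d) i p B (replicate m W) W
            (outer (amp_state N (2 * d) (uniform_amp N) 0)) =
          hit_prob N p C i m (uniform_amp N) (2 * 0)"
        unfolding D_def B_def W_def using hd
        by (intro outcome_prob_grover Or col' i amp_state_carrier grover_step_failure) auto
      ultimately show ?thesis by (simp add: m)
    qed
    finally show ?thesis .
  qed
  moreover have "is_povm D N (proj_first D (2 * d))"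
    unfolding D_def by (rule proj_first_povm)
  moreover have "length Us = T" using T by (simp add: Us_def)
  ultimately show ?thesis
    using U W d unfolding D[symmetric]
    by (intro exI[of _ d] exI[of _ Us] exI[of _ W] exI[of _ "proj_first (2 * N * d) (2 * d)"]) auto
qed

theorem theorem8:
  fixes N :: nat and p :: real and Or :: "nat \<Rightarrow> complex mat"
  assumes "N \<ge> 2" and "0 < p" and "p \<le> 1"
    and "\<forall>i<N. is_unitary (2*N) (Or i)"
    and "\<forall>i<N. \<forall>j<N. Or i *\<^sub>v unit_vec (2*N) (2*j) =
            (if j = i then -1 else 1) \<cdot>\<^sub>v unit_vec (2*N) (2*j+1)"
  shows "\<exists>(d::nat) Us Uf M.
           d \<ge> 1 \<and>
           length Us = nat \<lfloor>pi / (2 * (2 * arcsin (1 / sqrt (real N))) * p)\<rfloor> \<and>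
           (\<forall>U \<in> set Us. is_unitary (2*N*d) U) \<and> is_unitary (2*N*d) Uf \<and>
           is_povm (2*N*d) N M \<and>
           (\<forall>i<N. Re (mtrace (M i * alg_final_state (2*N*d)
                      (tensor_id (2*N) d (oracle_channel p (Or i))) Us Uf)) \<ge> 1/4)"
proof -
  define T where "T = nat \<lfloor>pi / (2 * (2 * arcsin (1 / sqrt (real N))) * p)\<rfloor>"
  \<comment> \<open>History \<open>0\<close> means no earlier success, so \<open>{0}\<close> permits
    only one diffusion, \<open>UNIV\<close> one after every success.\<close>
  define C :: "nat set" where "C = (if N \<le> 24 then {0} else UNIV)"
  have hit: "hit_prob N p C i T (uniform_amp N) 0 \<ge> 1/4" if "i < N" for i
    using hit_prob_small[of N i p] hit_prob_large[of N i p] assms(1-3) that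
    by (simp add: C_def T_def)
  \<comment> \<open>The circuit prepares its state in the first round, so one query must be
    available. Below \<open>\<theta>\<close> is half the Grover angle, at most \<open>pi / 4\<close>
    because \<open>N \<ge> 2\<close>.\<close>
  have "T > 0"
  proof -
    define \<theta> where "\<theta> = arcsin (1 / sqrt (real N))"
    have "arcsin 0 < \<theta>"
      unfolding \<theta>_def using assms by (intro arcsin_less_arcsin) auto
    moreover have "\<theta> \<le> pi / 4"
      unfolding \<theta>_def using assms
      by (intro arcsin_inv_sqrt_le[of "sqrt 2"]) (auto simp: sin_45 real_div_sqrt field_simps)
    ultimately have \<theta>: "0 < \<theta>" "4 * \<theta> \<le> pi" by auto
    have "4 * \<theta> * p \<le> pi * 1"
      using \<theta> assms(2,3) by (intro mult_mono) auto
    then have "1 \<le> pi / (2 * (2 * \<theta>) * p)" using \<theta> assms(2) by simp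
    then show ?thesis unfolding T_def \<theta>_def[symmetric] by simp
  qed
  have "Or i \<in> carrier_mat (2*N) (2*N)" if "i < N" for i
    using assms(4) that by (simp add: is_unitary_def)
  then obtain d Us Uf M where "d \<ge> 1" "length Us = T" "\<forall>U \<in> set Us. is_unitary (2*N*d) U"
    "is_unitary (2*N*d) Uf" "is_povm (2*N*d) N M"
    "\<forall>i<N. Re (mtrace (M i * alg_final_state (2*N*d)
        (tensor_id (2*N) d (oracle_channel p (Or i))) Us Uf)) = hit_prob N p C i T (uniform_amp N) 0"
    using noisy_search[of N T Or p C] \<open>T > 0\<close> assms(1,5) by auto
  with hit show ?thesis
    unfolding T_def[symmetric]
    by (intro exI[of _ d] exI[of _ Us] exI[of _ Uf] exI[of _ M]) simp
qed

end
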